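(* Let $A$ be a separable C*-algebra and let $B\subseteq A$ be a closed *-subalgebra containing an approximate unit for $A$. Then the set $\mathfrak S_{A,B}$ of all slices is an inverse semigroup under the operation sending slices $M,N$ to the closed linear span of $\{mn:m\in M,\ n\in N\}$ (which is again a slice).
   Context: The normalizer of $B$ in $A$ is $N(B)=\{a\in A: a^*Ba\subseteq B,\ aBa^*\subseteq B\}$. A slice is a closed linear subspace $M\subseteq A$ with $M\subseteq N(B)$, $BM\subseteq M$ and $MB\subseteq M$. *)

theory Defs
  imports "HOL-Analysis.Analysis"
begin

text \<open>
  C*-algebras, not assumed to be unital. The complex scalar multiplication extends the real one
  coming from the library class, so that norm, completeness and topology are the library's.
\<close>

class cstar_algebra = real_normed_algebra + banach +
  fixes scaleC :: "complex \<Rightarrow> 'a \<Rightarrow> 'a"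
    and star :: "'a \<Rightarrow> 'a"
  assumes scaleC_add_right: "scaleC c (x + y) = scaleC c x + scaleC c y"
    and scaleC_add_left: "scaleC (c + d) x = scaleC c x + scaleC d x"
    and scaleC_scaleC: "scaleC c (scaleC d x) = scaleC (c * d) x"
    and scaleC_of_real: "scaleC (complex_of_real r) x = r *\<^sub>R x"
    and mult_scaleC_left: "scaleC c x * y = scaleC c (x * y)"
    and mult_scaleC_right: "x * scaleC c y = scaleC c (x * y)"
    and norm_scaleC: "norm (scaleC c x) = cmod c * norm x"
    and star_add: "star (x + y) = star x + star y"
    and star_scaleC: "star (scaleC c x) = scaleC (cnj c) (star x)"
    and star_mult: "star (x * y) = star y * star x"
    and star_star: "star (star x) = x"
    and cstar_identity: "norm (star x * x) = (norm x)\<^sup>2"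

global_interpretation complex_vector:
  vector_space "scaleC :: complex \<Rightarrow> 'a \<Rightarrow> 'a :: cstar_algebra"
proof
  show "scaleC 1 x = x" for x :: 'a
    using scaleC_of_real[of 1 x] by simp
qed (simp_all add: scaleC_add_right scaleC_add_left scaleC_scaleC)

definition closed_star_subalgebra :: "'a::cstar_algebra set \<Rightarrow> bool" where
  "closed_star_subalgebra B \<longleftrightarrow>
     complex_vector.subspace B \<and> closed B \<and>
     (\<forall>x\<in>B. \<forall>y\<in>B. x * y \<in> B) \<and> (\<forall>x\<in>B. star x \<in> B)"

text \<open>
  A net in \<open>B\<close> is represented by the filter on the algebra generated by its tails; conversely,
  every proper filter containing \<open>B\<close> arises so from a net in \<open>B\<close>. No boundedness, positivity or monotonicity
  of the net is required; conventions that do require these are special cases.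
\<close>

definition contains_approximate_unit :: "'a::cstar_algebra set \<Rightarrow> bool" where
  "contains_approximate_unit B \<longleftrightarrow>
     (\<exists>F. F \<noteq> bot \<and> (\<forall>\<^sub>F e in F. e \<in> B) \<and>
        (\<forall>a. ((\<lambda>e. e * a) \<longlongrightarrow> a) F \<and> ((\<lambda>e. a * e) \<longlongrightarrow> a) F))"

definition normalizer :: "'a::cstar_algebra set \<Rightarrow> 'a set" where
  "normalizer B = {a. (\<lambda>b. star a * b * a) ` B \<subseteq> B \<and> (\<lambda>b. a * b * star a) ` B \<subseteq> B}"

definition slices :: "'a::cstar_algebra set \<Rightarrow> 'a set set" where
  "slices B = {M. complex_vector.subspace M \<and> closed M \<and> M \<subseteq> normalizer B \<and>
     (\<forall>b\<in>B. \<forall>m\<in>M. b * m \<in> M) \<and> (\<forall>m\<in>M. \<forall>b\<in>B. m * b \<in> M)}"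

definition slice_mult :: "'a::cstar_algebra set \<Rightarrow> 'a set \<Rightarrow> 'a set" where
  "slice_mult M N = closure (complex_vector.span {m * n | m n. m \<in> M \<and> n \<in> N})"

definition inverse_semigroup_on :: "'s set \<Rightarrow> ('s \<Rightarrow> 's \<Rightarrow> 's) \<Rightarrow> bool" where
  "inverse_semigroup_on S f \<longleftrightarrow>
     (\<forall>x\<in>S. \<forall>y\<in>S. f x y \<in> S) \<and>
     (\<forall>x\<in>S. \<forall>y\<in>S. \<forall>z\<in>S. f (f x y) z = f x (f y z)) \<and>
     (\<forall>x\<in>S. \<exists>!y. y \<in> S \<and> f (f x y) x = x \<and> f (f y x) y = y)"

end

theory Submission
  imports Defs
begin

text \<open>
  Polarization and the approximate unit give \<open>M\<^sup>* M \<subseteq> B\<close> and \<open>M M\<^sup>* \<subseteq> B\<close> for every slice \<open>M\<close>.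
  The crucial point is that \<open>M\<close> is the closed span of \<open>M M\<^sup>* M\<close>, so that \<open>M\<^sup>*\<close> is an inverse of \<open>M\<close>.
  Instead of functional calculus this uses one explicit contraction: for \<open>\<parallel>x\<parallel> \<le> 1\<close> and \<open>h = x\<^sup>* x\<close>
  one has \<open>\<parallel>x - x h\<^sup>2 / 9\<parallel>\<^sup>2 \<le> 80 / 81\<close>, which is then iterated in \<open>M\<close>.
  For uniqueness, an idempotent slice satisfies \<open>E = E E\<^sup>* E = (E E\<^sup>*) (E\<^sup>* E) \<subseteq> B\<close>, and slices inside
  \<open>B\<close> are ideals of \<open>B\<close>, which commute because \<open>I J = I \<inter> J\<close>.
\<close>

section \<open>Norm estimates\<close>

lemma star_zero [simp]: "star 0 = (0::'a::cstar_algebra)"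
  using star_add[of 0 "0::'a"] by simp

lemma star_minus: "star (- x) = - star (x::'a::cstar_algebra)"
  using star_add[of x "- x"] by (simp add: eq_neg_iff_add_eq_0 add.commute)

lemma star_diff: "star (x - y) = star x - star (y::'a::cstar_algebra)"
  using star_add[of x "- y"] by (simp add: star_minus)

lemma star_scaleR: "star (r *\<^sub>R x) = r *\<^sub>R star (x::'a::cstar_algebra)"
  using star_scaleC[of "complex_of_real r" x] by (simp add: scaleC_of_real)

lemma norm_star: "norm (star x) = norm (x::'a::cstar_algebra)"
proof -
  have le: "norm y \<le> norm (star y)" for y :: 'a
  proof (cases "y = 0")
    case False
    have "norm y * norm y \<le> norm (star y) * norm y"
      using cstar_identity[of y] norm_mult_ineq[of "star y" y] by (simp add: power2_eq_square)
    then show ?thesis using False by simp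
  qed simp
  show ?thesis using le[of x] le[of "star x"] by (simp add: star_star)
qed

text \<open>Because \<open>u\<close> is skew, the cross terms in
  \<open>star (a + u * a) * (a + u * a)\<close> cancel. Letting \<open>1 + u\<close> act on
  \<open>a\<close> makes the estimate meaningful without a unit in the algebra.\<close>

lemma norm_add_skew_mult_le:
  fixes u a :: "'a::cstar_algebra"
  assumes "star u = - u"
  shows "norm (a + u * a) \<le> sqrt (1 + (norm u)\<^sup>2) * norm a"
proof -
  have "(norm (a + u * a))\<^sup>2 = norm (star (a + u * a) * (a + u * a))"
    by (simp add: cstar_identity)
  also have "star (a + u * a) * (a + u * a) = star a * a - star a * (u * (u * a))"
    by (simp add: star_add star_mult assms algebra_simps)
  also have "norm \<dots> \<le> norm (star a * a) + norm (star a * (u * (u * a)))"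
    by (rule norm_triangle_ineq4)
  also have "norm (star a * (u * (u * a))) \<le> norm (star a) * (norm u * (norm u * norm a))"
    by (meson mult_left_mono norm_ge_zero norm_mult_ineq order_trans)
  also have "norm (star a * a) + norm (star a) * (norm u * (norm u * norm a))
      = (1 + (norm u)\<^sup>2) * (norm a)\<^sup>2"
    by (simp add: cstar_identity norm_star power2_eq_square algebra_simps)
  finally have "(norm (a + u * a))\<^sup>2 \<le> (1 + (norm u)\<^sup>2) * (norm a)\<^sup>2" by simp
  then have "norm (a + u * a) \<le> sqrt ((1 + (norm u)\<^sup>2) * (norm a)\<^sup>2)"
    by (rule real_le_rsqrt)
  then show ?thesis by (simp add: real_sqrt_mult)
qed

text \<open>The left-hand side is the odd part of \<open>(1 + u)\<^sup>3\<close>.\<close>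

lemma norm_skew_cubic_mult_le:
  fixes u a :: "'a::cstar_algebra"
  assumes "star u = - u"
  shows "norm (3 *\<^sub>R (u * a) + u * (u * (u * a))) \<le> sqrt (1 + (norm u)\<^sup>2) ^ 3 * norm a"
proof -
  define s where "s = sqrt (1 + (norm u)\<^sup>2)"
  define v where "v = 3 *\<^sub>R (u * a) + u * (u * (u * a))"
  have cube: "norm (T (T (T a))) \<le> s ^ 3 * norm a"
    if T: "\<And>b. norm (T b) \<le> s * norm b" for T :: "'a \<Rightarrow> 'a"
  proof -
    have s: "0 \<le> s" by (simp add: s_def)
    have "norm (T (T (T a))) \<le> s * norm (T (T a))" by (rule T)
    also have "\<dots> \<le> s * (s * norm (T a))" by (intro mult_left_mono T s)
    also have "\<dots> \<le> s * (s * (s * norm a))" by (intro mult_left_mono T s)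
    finally show ?thesis by (simp add: power3_eq_cube)
  qed
  \<comment> \<open>\<open>P\<close> and \<open>Q\<close> are left multiplication by
    \<open>1 + u\<close> and \<open>1 - u\<close>. The even parts of their cubes cancel in the
    difference, leaving twice the odd part \<open>3 u + u^3\<close>; as \<open>- u\<close> is skew
    too, both maps have bound \<open>s\<close>.\<close>
  define P where "P b = b + u * b" for b
  define Q where "Q b = b + (- u) * b" for b
  have "P (P (P a)) - Q (Q (Q a)) = v + v"
  proof -
    have "3 *\<^sub>R (u * a) = u * a + u * a + u * a"
      using scaleR_left_distrib[of 1 2 "u * a"] scaleR_left_distrib[of 1 1 "u * a"] by simp
    then show ?thesis by (simp add: v_def P_def Q_def algebra_simps)
  qed
  moreover have "norm (P (P (P a))) \<le> s ^ 3 * norm a"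
    by (rule cube) (use norm_add_skew_mult_le[OF assms] in \<open>simp add: P_def s_def\<close>)
  moreover have "norm (Q (Q (Q a))) \<le> s ^ 3 * norm a"
  proof (rule cube)
    show "norm (Q b) \<le> s * norm b" for b
      using norm_add_skew_mult_le[of "- u" b] assms by (simp add: star_minus Q_def s_def)
  qed
  ultimately have "norm (v + v) \<le> 2 * (s ^ 3 * norm a)"
    using norm_triangle_ineq4[of "P (P (P a))" "Q (Q (Q a))"] by simp
  then show ?thesis
    by (simp add: scaleR_2[symmetric] v_def[symmetric] s_def[symmetric])
qed

text \<open>A multiple of \<open>h\<close> by an imaginary scalar is skew, and the odd part of
  \<open>(1 + u)^3\<close> is then a multiple of \<open>h - h^3 / 9\<close>. The value
  \<open>8/9\<close> is that of \<open>t - t^3 / 9\<close> at \<open>t = 1\<close>.\<close>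

lemma norm_selfadjoint_cubic_le:
  fixes h :: "'a::cstar_algebra"
  assumes h: "star h = h" and "norm h \<le> 1"
  shows "norm (h - (1/9) *\<^sub>R (h * h * h)) \<le> 8/9"
proof -
  define k where "k = h - (1/9) *\<^sub>R (h * h * h)"
  \<comment> \<open>The factor \<open>1 / sqrt 3\<close> is the positive real \<open>r\<close> for
    which \<open>(1 + \<i> r)^3\<close> is purely imaginary, so that bounding the odd part by the
    whole cube loses nothing at \<open>h = 1\<close>.\<close>
  define s where "s = \<i> / complex_of_real (sqrt 3)"
  define u where "u = scaleC s h"
  have s2: "s * s = complex_of_real (- 1/3)"
    by (simp add: s_def flip: of_real_mult)
  have ns: "cmod s = 1 / sqrt 3" by (simp add: s_def norm_divide)
  have nu: "(norm u)\<^sup>2 \<le> 1/3"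
    using assms(2) by (simp add: u_def norm_scaleC ns power_divide power_le_one)
  have su: "star u = - u"
  proof -
    have "cnj s = - s" by (simp add: s_def)
    then show ?thesis by (simp add: u_def star_scaleC h)
  qed
  have cub: "u * (u * (u * a)) = scaleC s ((- 1/3) *\<^sub>R (h * h * h * a))" for a
  proof -
    have "u * (u * (u * a)) = scaleC s (scaleC (s * s) (h * (h * (h * a))))"
      by (simp add: u_def mult_scaleC_left mult_scaleC_right scaleC_scaleC mult.assoc)
    then show ?thesis unfolding s2 scaleC_of_real by (simp add: mult.assoc)
  qed
  have eq: "3 *\<^sub>R (u * a) + u * (u * (u * a)) = scaleC s (3 *\<^sub>R (k * a))" for a
  proof -
    have "3 *\<^sub>R (u * a) = scaleC s (3 *\<^sub>R (h * a))"
      by (simp add: u_def mult_scaleC_left scaleC_scaleC mult.commute flip: scaleC_of_real)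
    then show ?thesis
      unfolding cub by (simp add: k_def algebra_simps flip: scaleC_add_right)
  qed
  \<comment> \<open>Choosing \<open>a = k\<close> in the bound for left multiplication by
    \<open>k\<close> gives a bound on \<open>k * k\<close>, whose norm is the square of
    \<open>norm k\<close> because \<open>k\<close> is selfadjoint.\<close>
  have "norm k * norm k \<le> 8/9 * norm k"
  proof -
    have sk: "star k = k"
      by (simp add: k_def star_diff star_scaleR star_mult h mult.assoc)
    have "(1 / sqrt 3) * (3 * norm (k * k)) \<le> sqrt (1 + (norm u)\<^sup>2) ^ 3 * norm k"
      using norm_skew_cubic_mult_le[OF su, of k] unfolding eq by (simp add: norm_scaleC ns)
    also have "\<dots> \<le> sqrt (4/3) ^ 3 * norm k"
      using nu by (intro mult_right_mono power_mono) auto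
    also have "sqrt (4/3) ^ 3 = (1 / sqrt 3) * (8/3)"
      by (simp add: real_sqrt_divide power3_eq_cube)
    finally have "norm (k * k) \<le> 8/9 * norm k"
      by (simp add: field_simps)
    then show ?thesis
      using cstar_identity[of k] by (simp add: sk power2_eq_square)
  qed
  then have "norm k \<le> 8/9"
    by (cases "k = 0") auto
  then show ?thesis by (simp add: k_def)
qed

text \<open>Formally the vector is \<open>y = x (1 - h^2 / 9)\<close>, so
  \<open>star y * y = k (1 - h^2 / 9)\<close> with \<open>k = h - h^3 / 9\<close>. The cubic
  estimate bounds its norm by \<open>8/9 + (1/9) (8/9) = 80/81\<close>.\<close>

lemma norm_contraction_unit_ball:
  fixes x :: "'a::cstar_algebra"
  assumes "norm x \<le> 1"
  defines "h \<equiv> star x * x"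
  shows "norm (x - (1/9) *\<^sub>R (x * h * h)) \<le> sqrt (80/81)"
proof -
  define k where "k = h - (1/9) *\<^sub>R (h * h * h)"
  have sh: "star h = h" by (simp add: h_def star_mult star_star)
  have nh: "norm h \<le> 1"
    using assms(1) by (simp add: h_def cstar_identity power_le_one)
  have nk: "norm k \<le> 8/9"
    unfolding k_def by (rule norm_selfadjoint_cubic_le[OF sh nh])
  have "norm (k * h * h) \<le> norm k * norm h * norm h"
    by (meson mult_right_mono norm_ge_zero norm_mult_ineq order_trans)
  also have "\<dots> \<le> 8/9 * 1 * 1"
    by (intro mult_mono nk nh) auto
  finally have nkh: "norm (k * h * h) \<le> 8/9" by simp
  let ?y = "x - (1/9) *\<^sub>R (x * h * h)"
  have "star ?y * ?y = k - (1/9) *\<^sub>R (k * h * h)"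
  proof -
    have hx: "star x * (x * z) = h * z" for z by (simp add: h_def mult.assoc)
    have sy: "star ?y = star x - (1/9) *\<^sub>R (h * h * star x)"
      by (simp add: star_diff star_scaleR star_mult sh mult.assoc)
    show ?thesis
      unfolding sy by (simp add: k_def algebra_simps hx flip: h_def)
  qed
  then have "(norm ?y)\<^sup>2 = norm (k - (1/9) *\<^sub>R (k * h * h))"
    using cstar_identity[of ?y] by simp
  also have "\<dots> \<le> norm k + norm ((1/9) *\<^sub>R (k * h * h))"
    by (rule norm_triangle_ineq4)
  also have "\<dots> \<le> 80/81"
    using nk nkh by simp
  finally show ?thesis by (rule real_le_rsqrt)
qed

text \<open>Scaling to the unit ball: the correction term is homogeneous of degree five in
  \<open>x\<close>, whence \<open>t = 1 / (9 (norm x)^4)\<close> for \<open>x \<noteq> 0\<close>.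
  Only the form of the correction and the uniform factor below 1 matter later.\<close>

lemma norm_contraction:
  fixes x :: "'a::cstar_algebra"
  obtains t where "norm (x - t *\<^sub>R (x * (star x * x) * (star x * x))) \<le> sqrt (80/81) * norm x"
proof (cases "x = 0")
  case True
  then show ?thesis using that[of 0] by simp
next
  case False
  define r where "r = inverse (norm x)"
  define z where "z = r *\<^sub>R x"
  define w where "w = x * (star x * x) * (star x * x)"
  have r: "norm x * r = 1" "0 < r" using False by (auto simp: r_def)
  have "norm z \<le> 1" using False by (simp add: z_def r_def)
  from norm_contraction_unit_ball[OF this]
  have le: "norm (z - (1/9) *\<^sub>R (z * (star z * z) * (star z * z))) \<le> sqrt (80/81)" .
  have "z * (star z * z) * (star z * z) = r ^ 5 *\<^sub>R w"
    by (simp add: z_def w_def star_scaleR eval_nat_numeral mult_ac)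
  moreover have "norm x * r ^ 5 = r ^ 4"
    using r(1) by (simp add: eval_nat_numeral flip: mult.assoc)
  ultimately have "x - (r ^ 4 / 9) *\<^sub>R w = norm x *\<^sub>R (z - (1/9) *\<^sub>R (z * (star z * z) * (star z * z)))"
    using r(1) by (simp add: scaleR_right_diff_distrib) (simp add: z_def)
  then have "norm (x - (r ^ 4 / 9) *\<^sub>R w)
      = norm x * norm (z - (1/9) *\<^sub>R (z * (star z * z) * (star z * z)))"
    by simp
  also have "\<dots> \<le> norm x * sqrt (80/81)"
    by (intro mult_left_mono le) auto
  finally show ?thesis
    using that[of "r ^ 4 / 9"] by (simp add: w_def mult.commute)
qed

section \<open>Closed complex subspaces\<close>

lemma complex_subspace_scaleR:
  "complex_vector.subspace S \<Longrightarrow> x \<in> S \<Longrightarrow> r *\<^sub>R x \<in> S"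
  for S :: "'a::cstar_algebra set"
  using complex_vector.subspace_scale[of S x "complex_of_real r"] by (simp add: scaleC_of_real)

lemma bounded_linear_scaleC: "bounded_linear (scaleC c :: 'a \<Rightarrow> 'a::cstar_algebra)"
proof (rule bounded_linear_intro[where K = "cmod c"])
  show "scaleC c (r *\<^sub>R x) = r *\<^sub>R scaleC c x" for r and x :: 'a
    by (simp add: scaleC_scaleC mult.commute flip: scaleC_of_real)
qed (simp_all add: scaleC_add_right norm_scaleC mult.commute)

lemma bounded_linear_star: "bounded_linear (star :: 'a \<Rightarrow> 'a::cstar_algebra)"
  by (rule bounded_linear_intro[where K = 1]) (simp_all add: star_add star_scaleR norm_star)

lemma closed_vimage_bounded_linear:
  "bounded_linear f \<Longrightarrow> closed K \<Longrightarrow> closed {x. f x \<in> K}"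
  using continuous_closed_vimage[of K f]
  by (simp add: linear_continuous_at vimage_def)

lemma complex_subspace_closure:
  fixes S :: "'a::cstar_algebra set"
  assumes S: "complex_vector.subspace S"
  shows "complex_vector.subspace (closure S)"
proof (rule complex_vector.subspaceI)
  show "0 \<in> closure S"
    using complex_vector.subspace_0[OF S] closure_subset by blast
  show "x + y \<in> closure S" if xy: "x \<in> closure S" "y \<in> closure S" for x y
  proof -
    obtain f g where "\<forall>n. f n \<in> S" "f \<longlonglongrightarrow> x" "\<forall>n. g n \<in> S" "g \<longlonglongrightarrow> y"
      using xy by (auto simp: closure_sequential)
    then show ?thesis
      unfolding closure_sequential
      by (intro exI[of _ "\<lambda>n. f n + g n"])
        (auto intro: tendsto_add complex_vector.subspace_add[OF S])
  qed
  show "scaleC c x \<in> closure S" if x: "x \<in> closure S" for c x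
  proof -
    obtain f where "\<forall>n. f n \<in> S" "f \<longlonglongrightarrow> x"
      using x by (auto simp: closure_sequential)
    then show ?thesis
      unfolding closure_sequential
      by (intro exI[of _ "\<lambda>n. scaleC c (f n)"])
        (auto intro: bounded_linear.tendsto[OF bounded_linear_scaleC]
          complex_vector.subspace_scale[OF S])
  qed
qed

section \<open>Closed span products: universal property, associativity, adjoints\<close>

lemma subspace_slice_mult: "complex_vector.subspace (slice_mult M N)"
  unfolding slice_mult_def by (intro complex_subspace_closure complex_vector.subspace_span)

lemma closed_slice_mult: "closed (slice_mult M N)"
  by (simp add: slice_mult_def)

lemma slice_multI: "m \<in> M \<Longrightarrow> n \<in> N \<Longrightarrow> m * n \<in> slice_mult M N"
  unfolding slice_mult_def
  by (rule subsetD[OF closure_subset], rule complex_vector.span_base) blast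

text \<open>Together with \<open>slice_multI\<close> this is the universal property of the product;
  from here on it replaces the definition, and inclusions are checked on elementary products
  only.\<close>

lemma slice_mult_least:
  assumes "complex_vector.subspace K" "closed K"
    and "\<And>m n. m \<in> M \<Longrightarrow> n \<in> N \<Longrightarrow> m * n \<in> K"
  shows "slice_mult M N \<subseteq> K"
  unfolding slice_mult_def
  by (intro closure_minimal complex_vector.span_minimal assms(1,2)) (use assms(3) in auto)

lemma slice_mult_mono: "M \<subseteq> M' \<Longrightarrow> N \<subseteq> N' \<Longrightarrow> slice_mult M N \<subseteq> slice_mult M' N'"
  by (intro slice_mult_least subspace_slice_mult closed_slice_mult slice_multI) auto

text \<open>Preimages of this kind serve as \<open>K\<close> in \<open>slice_mult_least\<close>:
  with all other factors frozen, a membership that is linear and closed in one factor passes from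
  elementary products to the whole product.\<close>

lemma subspace_vimage_mult_left:
  "complex_vector.subspace K \<Longrightarrow> complex_vector.subspace {x. a * x \<in> K}"
  for a :: "'a::cstar_algebra"
  by (simp add: complex_vector.subspace_def distrib_left mult_scaleC_right)

lemma subspace_vimage_mult_right:
  "complex_vector.subspace K \<Longrightarrow> complex_vector.subspace {x. x * a \<in> K}"
  for a :: "'a::cstar_algebra"
  by (simp add: complex_vector.subspace_def distrib_right mult_scaleC_left)

lemma subspace_vimage_star:
  "complex_vector.subspace K \<Longrightarrow> complex_vector.subspace {x. star x \<in> K}"
  for K :: "'a::cstar_algebra set"
  by (simp add: complex_vector.subspace_def star_add star_scaleC)

lemma closed_vimage_mult_left: "closed K \<Longrightarrow> closed {x. a * x \<in> K}"
  for a :: "'a::cstar_algebra"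
  by (rule closed_vimage_bounded_linear[OF bounded_linear_mult_right])

lemma closed_vimage_mult_right: "closed K \<Longrightarrow> closed {x. x * a \<in> K}"
  for a :: "'a::cstar_algebra"
  by (rule closed_vimage_bounded_linear[OF bounded_linear_mult_left])

lemma closed_vimage_star: "closed K \<Longrightarrow> closed {x. star x \<in> K}"
  for K :: "'a::cstar_algebra set"
  by (rule closed_vimage_bounded_linear[OF bounded_linear_star])

lemma image_star_eq: "star ` M = {x. star x \<in> M}" for M :: "'a::cstar_algebra set"
  by (auto simp: star_star intro: image_eqI[of _ star "star _"])

lemma star_star_image [simp]: "star ` star ` M = M" for M :: "'a::cstar_algebra set"
  by (simp add: image_image star_star)

lemma slice_mult_assoc: "slice_mult (slice_mult M N) P = slice_mult M (slice_mult N P)"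
proof
  show "slice_mult (slice_mult M N) P \<subseteq> slice_mult M (slice_mult N P)" (is "_ \<subseteq> ?R")
  proof (rule slice_mult_least[OF subspace_slice_mult closed_slice_mult])
    fix x p assume "x \<in> slice_mult M N" "p \<in> P"
    moreover have "slice_mult M N \<subseteq> {x. x * p \<in> ?R}"
      using \<open>p \<in> P\<close>
      by (intro slice_mult_least subspace_vimage_mult_right closed_vimage_mult_right
          subspace_slice_mult closed_slice_mult) (simp add: mult.assoc slice_multI)
    ultimately show "x * p \<in> ?R" by blast
  qed
  show "slice_mult M (slice_mult N P) \<subseteq> slice_mult (slice_mult M N) P" (is "_ \<subseteq> ?L")
  proof (rule slice_mult_least[OF subspace_slice_mult closed_slice_mult])
    fix m x assume "m \<in> M" "x \<in> slice_mult N P"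
    moreover have "slice_mult N P \<subseteq> {x. m * x \<in> ?L}"
      using \<open>m \<in> M\<close>
      by (intro slice_mult_least subspace_vimage_mult_left closed_vimage_mult_left
          subspace_slice_mult closed_slice_mult) (simp flip: mult.assoc add: slice_multI)
    ultimately show "m * x \<in> ?L" by blast
  qed
qed

lemma star_slice_mult: "star ` slice_mult M N = slice_mult (star ` N) (star ` M)"
proof -
  have sub: "slice_mult M N \<subseteq> star ` slice_mult (star ` N) (star ` M)" for M N :: "'a set"
    unfolding image_star_eq[of "slice_mult _ _"]
    by (intro slice_mult_least subspace_vimage_star closed_vimage_star
        subspace_slice_mult closed_slice_mult) (auto simp: star_mult intro: slice_multI)
  show ?thesis
    \<comment> \<open>One inclusion is \<open>sub\<close> for the starred sets in reverse order; the
      other is the image of \<open>sub\<close> under the involution \<open>star\<close>.\<close>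
    using sub[of "star ` N" "star ` M"] image_mono[OF sub[of M N], of star] by simp
qed

text \<open>No completeness of the quotient is needed: the defect \<open>x - y\<close> stays in \<open>M\<close> and is approximated again.\<close>

lemma subset_if_contraction_mod:
  fixes K M :: "'a::cstar_algebra set"
  assumes K: "complex_vector.subspace K" "closed K" "K \<subseteq> M"
    and M: "complex_vector.subspace M"
    and c: "0 \<le> c" "c < 1"
    and approx: "\<And>x. x \<in> M \<Longrightarrow> \<exists>y\<in>K. norm (x - y) \<le> c * norm x"
  shows "M \<subseteq> K"
proof
  fix x assume x: "x \<in> M"
  have iter: "\<exists>y\<in>K. norm (x - y) \<le> c ^ n * norm x" for n
  proof (induction n)
    case 0
    show ?case using complex_vector.subspace_0[OF K(1)] by (intro bexI[of _ 0]) auto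
  next
    case (Suc n)
    then obtain y where y: "y \<in> K" "norm (x - y) \<le> c ^ n * norm x" by blast
    have "x - y \<in> M"
      using x y(1) K(3) complex_vector.subspace_diff[OF M] by blast
    then obtain z where z: "z \<in> K" "norm (x - y - z) \<le> c * norm (x - y)"
      using approx by blast
    have "norm (x - (y + z)) \<le> c * (c ^ n * norm x)"
      using z(2) mult_left_mono[OF y(2) c(1)] by (simp add: diff_diff_eq)
    then show ?case
      using y(1) z(1) complex_vector.subspace_add[OF K(1)] by (auto simp: mult.assoc)
  qed
  then obtain f where f: "\<And>n. f n \<in> K" "\<And>n. norm (x - f n) \<le> c ^ n * norm x"
    by metis
  have "(\<lambda>n. c ^ n * norm x) \<longlonglongrightarrow> 0"
    using c by (intro tendsto_mult_left_zero LIMSEQ_power_zero) auto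
  then have "(\<lambda>n. x - f n) \<longlonglongrightarrow> 0"
    by (rule Lim_null_comparison[rotated]) (simp add: f(2))
  then have "f \<longlonglongrightarrow> x"
    using tendsto_diff[OF tendsto_const, of "\<lambda>n. x - f n" 0 sequentially x] by simp
  then show "x \<in> K"
    using closed_sequentially[OF K(2)] f(1) by blast
qed

section \<open>Slices\<close>

context
  fixes B :: "'a::cstar_algebra set"
  assumes B: "closed_star_subalgebra B"
begin

lemma B_subspace: "complex_vector.subspace B"
  and B_closed: "closed B"
  and B_mult: "x \<in> B \<Longrightarrow> y \<in> B \<Longrightarrow> x * y \<in> B"
  and B_star: "x \<in> B \<Longrightarrow> star x \<in> B"
  using B by (auto simp: closed_star_subalgebra_def)

lemma sliceD:
  assumes "M \<in> slices B"
  shows "complex_vector.subspace M" "closed M" "M \<subseteq> normalizer B"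
    "\<And>b m. b \<in> B \<Longrightarrow> m \<in> M \<Longrightarrow> b * m \<in> M" "\<And>b m. b \<in> B \<Longrightarrow> m \<in> M \<Longrightarrow> m * b \<in> M"
  using assms by (auto simp: slices_def)

section \<open>Slices are stable under adjoints and products\<close>

lemma star_slice:
  assumes M: "M \<in> slices B"
  shows "star ` M \<in> slices B"
proof -
  have "b * m \<in> star ` M" if "b \<in> B" "m \<in> star ` M" for b m
    using that sliceD(5)[OF M B_star] by (simp add: image_star_eq star_mult)
  moreover have "m * b \<in> star ` M" if "b \<in> B" "m \<in> star ` M" for b m
    using that sliceD(4)[OF M B_star] by (simp add: image_star_eq star_mult)
  moreover have "star ` M \<subseteq> normalizer B"
    using sliceD(3)[OF M] by (fastforce simp: normalizer_def star_star)
  moreover have "complex_vector.subspace (star ` M)" "closed (star ` M)"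
    unfolding image_star_eq
    by (intro subspace_vimage_star closed_vimage_star sliceD[OF M])+
  ultimately show ?thesis by (simp add: slices_def)
qed

text \<open>The normalizer condition covers only the diagonal \<open>m = n\<close> of the
  sesquilinear expression \<open>star m * b * n\<close>. Since \<open>M\<close> is a complex
  subspace, polarization recovers the rest.\<close>

lemma slice_polarization:
  assumes M: "M \<in> slices B" and "m \<in> M" "n \<in> M" and b: "b \<in> B"
  shows "star m * b * n \<in> B"
proof -
  note sM = sliceD(1)[OF M]
  have diag: "star x * b * x \<in> B" if "x \<in> M" for x
    using sliceD(3)[OF M] that b by (auto simp: normalizer_def)
  have sym: "star x * b * y + star y * b * x \<in> B" if "x \<in> M" "y \<in> M" for x y
  proof -
    have "star (x + y) * b * (x + y) - star x * b * x - star y * b * y \<in> B"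
      using that by (intro complex_vector.subspace_diff[OF B_subspace] diag
          complex_vector.subspace_add[OF sM])
    then show ?thesis by (simp add: star_add algebra_simps)
  qed
  define p where "p = star m * b * n"
  define q where "q = star n * b * m"
  have 1: "p + q \<in> B"
    unfolding p_def q_def by (intro sym assms)
  \<comment> \<open>This is \<open>sym\<close> for \<open>m\<close> and \<open>\<i> n\<close>: the
    adjoint is conjugate linear, so the second summand changes sign.\<close>
  have "scaleC \<i> p - scaleC \<i> q \<in> B"
    using sym[of m "scaleC \<i> n"] assms complex_vector.subspace_scale[OF sM]
    by (simp add: p_def q_def star_scaleC mult_scaleC_left mult_scaleC_right)
  then have "scaleC (- \<i>) (scaleC \<i> p - scaleC \<i> q) \<in> B"
    by (rule complex_vector.subspace_scale[OF B_subspace])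
  then have 2: "p - q \<in> B"
    by (simp add: complex_vector.scale_right_diff_distrib)
  have "(1/2) *\<^sub>R ((p + q) + (p - q)) \<in> B"
    by (intro complex_subspace_scaleR complex_vector.subspace_add B_subspace 1 2)
  then show ?thesis by (simp add: p_def flip: scaleR_2)
qed

text \<open>Membership of \<open>star x * b * x\<close> in \<open>B\<close> is not linear in
  \<open>x\<close> and cannot be extended directly from elementary products. With two independent
  variables it can, first in \<open>y\<close> and then in \<open>x\<close>; on elementary products
  it is polarization in \<open>M\<close> followed by polarization in \<open>N\<close>.\<close>

lemma slice_mult_sandwich:
  assumes M: "M \<in> slices B" and N: "N \<in> slices B"
    and "x \<in> slice_mult M N" "y \<in> slice_mult M N" and b: "b \<in> B"
  shows "star x * b * y \<in> B"
proof -
  have gen: "star (m * n) * b * (m' * n') \<in> B"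
    if "m \<in> M" "n \<in> N" "m' \<in> M" "n' \<in> N" for m n m' n'
    using slice_polarization[OF N that(2,4) slice_polarization[OF M that(1,3) b]]
    by (simp add: star_mult mult.assoc)
  have right: "slice_mult M N \<subseteq> {y. star (m * n) * b * y \<in> B}" if "m \<in> M" "n \<in> N" for m n
    by (intro slice_mult_least subspace_vimage_mult_left closed_vimage_mult_left
        B_subspace B_closed) (use gen that in blast)
  have "slice_mult M N \<subseteq> {x. star x \<in> {z. z * (b * y) \<in> B}}"
    by (intro slice_mult_least subspace_vimage_star closed_vimage_star subspace_vimage_mult_right
        closed_vimage_mult_right B_subspace B_closed)
      (use right assms(4) in \<open>force simp: mult.assoc\<close>)
  then show ?thesis using assms(3) by (auto simp: mult.assoc)
qed

lemma slice_mult_slice: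
  assumes M: "M \<in> slices B" and N: "N \<in> slices B"
  shows "slice_mult M N \<in> slices B"
proof -
  have "b * x \<in> slice_mult M N" if "x \<in> slice_mult M N" "b \<in> B" for b x
  proof -
    have "slice_mult M N \<subseteq> {x. b * x \<in> slice_mult M N}"
      using that(2) sliceD(4)[OF M]
      by (intro slice_mult_least subspace_vimage_mult_left closed_vimage_mult_left
          subspace_slice_mult closed_slice_mult) (simp flip: mult.assoc add: slice_multI)
    then show ?thesis using that by blast
  qed
  moreover have "x * b \<in> slice_mult M N" if "x \<in> slice_mult M N" "b \<in> B" for b x
  proof -
    have "slice_mult M N \<subseteq> {x. x * b \<in> slice_mult M N}"
      using that(2) sliceD(5)[OF N]
      by (intro slice_mult_least subspace_vimage_mult_right closed_vimage_mult_right
          subspace_slice_mult closed_slice_mult) (simp add: mult.assoc slice_multI)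
    then show ?thesis using that by blast
  qed
  \<comment> \<open>The second normalizer condition is the sandwich property of the adjoint product,
    which contains \<open>star x\<close>.\<close>
  moreover have "x * b * star x \<in> B" if "x \<in> slice_mult M N" "b \<in> B" for b x
  proof -
    have "star x \<in> slice_mult (star ` N) (star ` M)"
      using that(1) by (simp flip: star_slice_mult)
    from slice_mult_sandwich[OF star_slice[OF N] star_slice[OF M] this this that(2)]
    show ?thesis by (simp add: star_star)
  qed
  ultimately show ?thesis
    using slice_mult_sandwich[OF M N]
    by (auto simp: slices_def normalizer_def subspace_slice_mult closed_slice_mult)
qed

section \<open>Regularity of slices from the approximate unit\<close>

context
  assumes unit: "contains_approximate_unit B"
begin

text \<open>Along the approximate unit, \<open>star m * n\<close> is the limit of the elements
  \<open>star m * e * n\<close>, which lie in the closed set \<open>B\<close> by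
  polarization.\<close>

lemma slice_star_mult_in_B:
  assumes M: "M \<in> slices B" "m \<in> M" "n \<in> M"
  shows "star m * n \<in> B"
proof -
  obtain F where F: "F \<noteq> bot" "\<forall>\<^sub>F e in F. e \<in> B" "((\<lambda>e. e * n) \<longlongrightarrow> n) F"
    using unit by (auto simp: contains_approximate_unit_def)
  have "((\<lambda>e. star m * (e * n)) \<longlongrightarrow> star m * n) F"
    by (intro tendsto_intros F)
  moreover have "\<forall>\<^sub>F e in F. star m * (e * n) \<in> B"
    using F(2) by eventually_elim (use slice_polarization[OF M] in \<open>simp add: mult.assoc\<close>)
  ultimately show ?thesis
    by (intro Lim_in_closed_set[OF B_closed _ F(1)])
qed

lemma slice_mult_star_subset_B:
  assumes M: "M \<in> slices B"
  shows "slice_mult M (star ` M) \<subseteq> B"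
proof (rule slice_mult_least[OF B_subspace B_closed])
  show "m * n \<in> B" if "m \<in> M" "n \<in> star ` M" for m n
    using slice_star_mult_in_B[OF star_slice[OF M], of "star m" n] that by (simp add: star_star)
qed

lemma slice_regular:
  assumes M: "M \<in> slices B"
  shows "slice_mult (slice_mult M (star ` M)) M = M" (is "?K = M")
proof
  show KM: "?K \<subseteq> M"
    using slice_mult_star_subset_B[OF M] sliceD[OF M] by (intro slice_mult_least) auto
  show "M \<subseteq> ?K"
  proof (rule subset_if_contraction_mod[where c = "sqrt (80/81)"])
    fix x assume x: "x \<in> M"
    obtain t where t: "norm (x - t *\<^sub>R (x * (star x * x) * (star x * x))) \<le> sqrt (80/81) * norm x"
      by (rule norm_contraction)
    have "x * (star x * x) \<in> M"
      using x slice_star_mult_in_B[OF M x x] sliceD(5)[OF M] by blast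
    \<comment> \<open>The correction term regroups as an element of \<open>M\<close> times its
      adjoint, followed by \<open>x * star x * x\<close>, which is in \<open>M\<close> because
      \<open>star x * x\<close> is in \<open>B\<close>.\<close>
    then have "(x * star x) * (x * (star x * x)) \<in> ?K"
      using x by (intro slice_multI) auto
    then have "t *\<^sub>R (x * (star x * x) * (star x * x)) \<in> ?K"
      by (intro complex_subspace_scaleR subspace_slice_mult) (simp add: mult.assoc)
    with t show "\<exists>y\<in>?K. norm (x - y) \<le> sqrt (80/81) * norm x" by blast
  qed (use KM sliceD(1)[OF M] in \<open>simp_all add: subspace_slice_mult closed_slice_mult\<close>)
qed

section \<open>Idempotent slices and uniqueness of inverses\<close>

lemma idempotent_slice_subset_B:
  assumes E: "E \<in> slices B" and "slice_mult E E = E"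
  shows "E \<subseteq> B"
proof -
  \<comment> \<open>The adjoint of an idempotent slice is idempotent, so the middle factor of the
    regularity identity may be doubled and the word split into two factors inside
    \<open>B\<close>.\<close>
  have "slice_mult (star ` E) (star ` E) = star ` E"
    using assms(2) by (simp flip: star_slice_mult)
  then have "E = slice_mult (slice_mult E (slice_mult (star ` E) (star ` E))) E"
    by (simp only: slice_regular[OF E])
  then have "E = slice_mult (slice_mult E (star ` E)) (slice_mult (star ` E) E)"
    by (simp only: slice_mult_assoc)
  also have "\<dots> \<subseteq> B"
    using slice_mult_star_subset_B[OF E] slice_mult_star_subset_B[OF star_slice[OF E]]
    by (intro slice_mult_least B_subspace B_closed B_mult) auto
  finally show ?thesis .
qed

text \<open>Slices inside \<open>B\<close> are two-sided ideals of \<open>B\<close>, so the product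
  lies in both. Conversely \<open>L = I \<inter> J\<close> is a slice, and regularity writes it as
  \<open>L\<close> times \<open>star L\<close> times \<open>L\<close>, where the first factor is in
  \<open>I\<close> and the product of the last two is in \<open>J\<close>.\<close>

lemma slice_mult_eq_Int:
  assumes I: "I \<in> slices B" "I \<subseteq> B" and J: "J \<in> slices B" "J \<subseteq> B"
  shows "slice_mult I J = I \<inter> J"
proof
  have "slice_mult I J \<subseteq> I"
    using I(1) J(2) by (intro slice_mult_least sliceD) auto
  moreover have "slice_mult I J \<subseteq> J"
    using I(2) J(1) by (intro slice_mult_least sliceD) auto
  ultimately show "slice_mult I J \<subseteq> I \<inter> J" by simp
  define L where "L = I \<inter> J"
  have L: "L \<in> slices B"
    using I(1) J(1) unfolding L_def slices_def
    by (auto intro: complex_vector.subspace_inter)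
  have "L = slice_mult L (slice_mult (star ` L) L)"
    using slice_regular[OF L] by (simp add: slice_mult_assoc)
  also have "slice_mult (star ` L) L \<subseteq> J"
    using J I(2) B_star by (intro slice_mult_least sliceD) (auto simp: L_def)
  then have "slice_mult L (slice_mult (star ` L) L) \<subseteq> slice_mult I J"
    by (intro slice_mult_mono) (auto simp: L_def)
  finally show "I \<inter> J \<subseteq> slice_mult I J" by (simp add: L_def)
qed

lemma idempotent_slices_commute:
  assumes "E \<in> slices B" "slice_mult E E = E" "F \<in> slices B" "slice_mult F F = F"
  shows "slice_mult E F = slice_mult F E"
  using slice_mult_eq_Int[of E F] slice_mult_eq_Int[of F E]
    idempotent_slice_subset_B[of E] idempotent_slice_subset_B[of F] assms
  by (simp only: Int_commute)

text \<open>The classical argument that commuting idempotents force unique inverses: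
  \<open>Y = Y(XZ)(XY) = Y(XY)(XZ) = (YX)(ZX)Z = (ZX)(YX)Z = Z\<close>.\<close>

lemma slice_inverse_unique:
  assumes X: "X \<in> slices B" and Y: "Y \<in> slices B" and Z: "Z \<in> slices B"
    and XY: "slice_mult (slice_mult X Y) X = X" "slice_mult (slice_mult Y X) Y = Y"
    and XZ: "slice_mult (slice_mult X Z) X = X" "slice_mult (slice_mult Z X) Z = Z"
  shows "Y = Z"
proof -
  \<comment> \<open>In right-nested words \<open>P Q P\<close> may be followed by a tail
    \<open>W\<close>, where the bare identity does not match; \<open>ext\<close> covers this case,
    so \<open>reduce\<close> can simplify inside words.\<close>
  have ext: "slice_mult P (slice_mult Q (slice_mult P W)) = slice_mult P W"
    if "slice_mult (slice_mult P Q) P = P" for P Q W :: "'a set"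
    using arg_cong[OF that, of "\<lambda>V. slice_mult V W"] by (simp only: slice_mult_assoc)
  note reduce = XY[unfolded slice_mult_assoc] XZ[unfolded slice_mult_assoc]
    ext[OF XY(1)] ext[OF XY(2)] ext[OF XZ(1)] ext[OF XZ(2)] slice_mult_assoc
  have right: "slice_mult (slice_mult X Z) (slice_mult X Y) = slice_mult (slice_mult X Y) (slice_mult X Z)"
    by (intro idempotent_slices_commute slice_mult_slice X Y Z) (simp_all only: reduce)
  have left: "slice_mult (slice_mult Y X) (slice_mult Z X) = slice_mult (slice_mult Z X) (slice_mult Y X)"
    by (intro idempotent_slices_commute slice_mult_slice X Y Z) (simp_all only: reduce)
  have "Y = slice_mult Y (slice_mult (slice_mult X Z) (slice_mult X Y))"
    by (simp only: reduce)
  also have "\<dots> = slice_mult (slice_mult (slice_mult Y X) (slice_mult Z X)) Z"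
    unfolding right by (simp only: reduce)
  also have "\<dots> = Z"
    unfolding left by (simp only: reduce)
  finally show ?thesis .
qed

end

end

theorem proposition13p3:
  fixes B :: "'a::cstar_algebra set"
  assumes "separable_space (euclidean :: 'a topology)"
    and "closed_star_subalgebra B"
    and "contains_approximate_unit B"
  shows "inverse_semigroup_on (slices B) slice_mult"
  unfolding inverse_semigroup_on_def
proof (intro conjI ballI)
  show "slice_mult M N \<in> slices B" if "M \<in> slices B" "N \<in> slices B" for M N
    using slice_mult_slice[OF assms(2)] that .
  show "slice_mult (slice_mult M N) P = slice_mult M (slice_mult N P)" for M N P :: "'a set"
    by (rule slice_mult_assoc)
  fix M assume M: "M \<in> slices B"
  show "\<exists>!N. N \<in> slices B \<and> slice_mult (slice_mult M N) M = M \<and> slice_mult (slice_mult N M) N = N"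
  proof (rule ex1I[of _ "star ` M"])
    show "star ` M \<in> slices B \<and> slice_mult (slice_mult M (star ` M)) M = M
        \<and> slice_mult (slice_mult (star ` M) M) (star ` M) = star ` M"
      \<comment> \<open>The second inverse equation is regularity of the adjoint slice, whose own
        adjoint is \<open>M\<close> again.\<close>
      using star_slice[OF assms(2) M] slice_regular[OF assms(2,3) M]
        slice_regular[OF assms(2,3) star_slice[OF assms(2) M]] by simp
    then show "N = star ` M"
      if "N \<in> slices B \<and> slice_mult (slice_mult M N) M = M \<and> slice_mult (slice_mult N M) N = N" for N
      using slice_inverse_unique[OF assms(2,3) M] that by blast
  qed
qed

end
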